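(* Let $N,d\ge 1$ be integers, let $J=\{0,1,\dots,2N-1\}^d$, and suppose that $\boldsymbol a=(a_{\boldsymbol k}:\boldsymbol k\in J)\in\mathbb R^J$ is the DFT magnitude data of a real image. For any point $\boldsymbol f\in\mathbb A_{\boldsymbol a}$ (the magnitude torus of $\boldsymbol a$), set, for $\boldsymbol v\in J$, $$\boldsymbol\tau^{\boldsymbol v}:=\boldsymbol f^{(\boldsymbol v)}-\boldsymbol f^{(-\boldsymbol v)},\qquad \boldsymbol\nu^{\boldsymbol v}:=\boldsymbol f^{(\boldsymbol v)}+\boldsymbol f^{(-\boldsymbol v)}.$$ Then $$T^0_{\boldsymbol f}\mathbb A_{\boldsymbol a}=\operatorname{span}_{\mathbb R}\{\boldsymbol\tau^{\boldsymbol v}:\boldsymbol v\in J\},\qquad N^0_{\boldsymbol f}\mathbb A_{\boldsymbol a}=\operatorname{span}_{\mathbb R}\{\boldsymbol\nu^{\boldsymbol v}:\boldsymbol v\in J\}.$$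
   Context: An image is a vector $\boldsymbol f=(f_{\boldsymbol j}:\boldsymbol j\in J)\in\mathbb R^J$. Images are regarded as $2N$-periodic in each index, i.e. all indices are taken modulo $2N$ in each coordinate. The discrete Fourier transform (DFT) of $\boldsymbol f$ is $$\hat f_{\boldsymbol k}=\sum_{\boldsymbol j\in J}f_{\boldsymbol j}\exp\left(\frac{2\pi i\,\boldsymbol j\cdot\boldsymbol k}{2N}\right),\qquad \boldsymbol k\in J,$$ and its DFT magnitude data is $(|\hat f_{\boldsymbol k}|:\boldsymbol k\in J)$. The magnitude torus of $\boldsymbol a$ is $\mathbb A_{\boldsymbol a}=\{\boldsymbol f\in\mathbb R^J: |\hat f_{\boldsymbol k}|=a_{\boldsymbol k}\text{ for all }\boldsymbol k\in J\}$. When non-empty it is a real torus or a union of real tori, and is a real analytic submanifold of $\mathbb R^J$. For $\boldsymbol v\in\mathbb Z^d$, the translate $\boldsymbol f^{(\boldsymbol v)}$ is defined by $f^{(\boldsymbol v)}_{\boldsymbol j}=f_{\boldsymbol j-\boldsymbol v}$ (indices mod $2N$). $T^0_{\boldsymbol f}\mathbb A_{\boldsymbol a}\subset\mathbb R^J$ denotes the tangent space to $\mathbb A_{\boldsymbol a}$ at $\boldsymbol f$, viewed as a linear subspace of $\mathbb R^J$ (so the affine subspace through $\boldsymbol f$ that best approximates $\mathbb A_{\boldsymbol a}$ near $\boldsymbol f$ is $\boldsymbol f+T^0_{\boldsymbol f}\mathbb A_{\boldsymbol a}$). $N^0_{\boldsymbol f}\mathbb A_{\boldsymbol a}$ denotes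 the normal space at $\boldsymbol f$, i.e. the orthogonal complement of $T^0_{\boldsymbol f}\mathbb A_{\boldsymbol a}$ in $\mathbb R^J$ with respect to the Euclidean inner product.
   Formalization: The normal-space equality is proved under the added assumption that all a_k are nonzero; it fails whenever some a_k = 0 (e.g. f = 0, where the normal space is all of R^J but every ν^v is 0). The tangent-space equality is unconditional. *)

theory Defs
  imports "HOL-Analysis.Analysis"
begin

text \<open>
  The parameters are carried by finite index types: \<open>N = CARD('n)\<close> and \<open>d = CARD('d)\<close>, both
  arbitrary positive integers.  The library type \<open>'n bit0\<close> is the ring of integers modulo
  \<open>2 * CARD('n)\<close>, with representatives \<open>Rep_bit0 x\<close> in \<open>{0..<2 * CARD('n)}\<close>.  Hence the type
  \<open>'n bit0 ^ 'd\<close> is the index set \<open>J\<close>, and its addition, subtraction and negation are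
  coordinatewise modulo \<open>2N\<close>, which is the periodicity convention for images.
\<close>

type_synonym ('n, 'd) index = "'n bit0 ^ 'd"

type_synonym ('n, 'd) image = "real ^ ('n, 'd) index"

definition index_dot :: "('n::finite, 'd::finite) index \<Rightarrow> ('n, 'd) index \<Rightarrow> int" where
  "index_dot j k = (\<Sum>i\<in>UNIV. Rep_bit0 (j $ i) * Rep_bit0 (k $ i))"

definition dft :: "('n::finite, 'd::finite) image \<Rightarrow> ('n, 'd) index \<Rightarrow> complex" where
  "dft f k = (\<Sum>j\<in>UNIV. complex_of_real (f $ j) *
     exp (2 * complex_of_real pi * \<i> * of_int (index_dot j k) / (2 * of_nat CARD('n))))"

definition magnitude_data :: "('n::finite, 'd::finite) image \<Rightarrow> ('n, 'd) image" where
  "magnitude_data f = (\<chi> k. cmod (dft f k))"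

definition magnitude_torus :: "('n::finite, 'd::finite) image \<Rightarrow> ('n, 'd) image set" where
  "magnitude_torus a = {f. \<forall>k. cmod (dft f k) = a $ k}"

text \<open>
  A translate depends only on the residue class of the integer translation vector, so the
  vector is taken in \<open>J\<close>; \<open>translate (- v) f\<close> is the translate by the negated vector.
\<close>

definition translate ::
    "('n::finite, 'd::finite) index \<Rightarrow> ('n, 'd) image \<Rightarrow> ('n, 'd) image" where
  "translate v f = (\<chi> j. f $ (j - v))"

definition tau :: "('n::finite, 'd::finite) image \<Rightarrow> ('n, 'd) index \<Rightarrow> ('n, 'd) image" where
  "tau f v = translate v f - translate (- v) f"

definition nu :: "('n::finite, 'd::finite) image \<Rightarrow> ('n, 'd) index \<Rightarrow> ('n, 'd) image" where
  "nu f v = translate v f + translate (- v) f"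

text \<open>
  The tangent space at \<open>p\<close> of a submanifold \<open>M\<close> of a Euclidean space, as a set of direction
  vectors based at the origin: the velocities at \<open>p\<close> of the \<open>C\<^sup>1\<close> curves that lie in \<open>M\<close> and
  pass through \<open>p\<close> at time 0.
\<close>

definition tangent_space_at :: "'a::euclidean_space set \<Rightarrow> 'a \<Rightarrow> 'a set" where
  "tangent_space_at M p = {w. \<exists>\<gamma> e. 0 < e \<and> \<gamma> C1_differentiable_on {-e<..<e} \<and>
     \<gamma> ` {-e<..<e} \<subseteq> M \<and> \<gamma> 0 = p \<and> (\<gamma> has_vector_derivative w) (at 0)}"

text \<open>
  The normal space is the orthogonal complement of the tangent space.  For a magnitude torus
  of \<open>a\<close> it contains, whenever \<open>a $ k = 0\<close>, every image whose transform is supported on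
  \<open>{k, - k}\<close>, whereas the transforms of all \<open>nu f v\<close> vanish at such \<open>k\<close>.  A description of
  the normal space by the vectors \<open>nu f v\<close> therefore requires all \<open>a $ k\<close> to be nonzero.
\<close>

definition normal_space_at :: "'a::euclidean_space set \<Rightarrow> 'a \<Rightarrow> 'a set" where
  "normal_space_at M p = orthogonal_comp (tangent_space_at M p)"

end

theory Submission
  imports Defs
begin

text \<open>
  On the transform side the magnitude torus is a product of circles, so the velocities at \<open>f\<close>
  are the images \<open>w\<close> with \<open>dft w k = \<i> \<theta>\<^sub>k dft f k\<close> for real \<open>\<theta>\<^sub>k\<close>, realised by the curves
  with transform \<open>exp (\<i> t \<theta>\<^sub>k) dft f k\<close>.  A combination of the \<open>tau f v\<close> with coefficients \<open>g\<close>
  multiplies \<open>dft f k\<close> by \<open>dft g k - dft g (- k)\<close>, that is, by a purely imaginary number that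
  Fourier inversion makes arbitrary (up to oddness in \<open>k\<close>).  The vectors \<open>tau f u\<close> and
  \<open>nu f v\<close> are orthogonal because the autocorrelation of \<open>f\<close> is even, and if no \<open>dft f k\<close>
  vanishes then every image is a convolution of \<open>f\<close> with an odd plus an even image, so the two
  spans together fill the space.
\<close>

section \<open>Characters of the index group\<close>

definition dft_char :: "('n::finite, 'd::finite) index \<Rightarrow> ('n, 'd) index \<Rightarrow> complex" where
  "dft_char j k =
     exp (2 * complex_of_real pi * \<i> * of_int (index_dot j k) / (2 * of_nat CARD('n)))"

lemma dft_eq: "dft f k = (\<Sum>j\<in>UNIV. complex_of_real (f $ j) * dft_char j k)"
  by (simp add: dft_def dft_char_def)

lemma index_dot_commute: "index_dot j k = index_dot k j"
  by (simp add: index_dot_def mult.commute)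

lemma dft_char_commute: "dft_char j k = dft_char k j"
  by (simp add: dft_char_def index_dot_commute)

lemma exp_cong_mod:
  assumes "m mod (2 * int n) = m' mod (2 * int n)" "n > 0"
  shows "exp (2 * complex_of_real pi * \<i> * of_int m / (2 * of_nat n))
       = exp (2 * complex_of_real pi * \<i> * of_int m' / (2 * of_nat n))"
proof -
  obtain q where q: "m = m' + q * (2 * int n)"
    using assms(1) by (metis mod_eqE add.commute mult.commute add_diff_cancel_left' diff_add_cancel)
  have "2 * complex_of_real pi * \<i> * of_int m / (2 * of_nat n)
      = 2 * complex_of_real pi * \<i> * of_int m' / (2 * of_nat n) + of_int (2 * q) * (complex_of_real pi * \<i>)"
    using assms(2) by (simp add: q field_simps)
  then show ?thesis
    unfolding exp_eq by (intro exI[of _ q]) (simp add: mult_ac)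
qed

text \<open>Representatives in \<open>{0..<2N}\<close> add only up to multiples of
  \<open>2N\<close>, so \<open>index_dot\<close> is additive modulo \<open>2N\<close> and no better;
  \<open>exp_cong_mod\<close> shows that the exponential sees nothing more.\<close>

lemma index_dot_add_mod:
  fixes j j' k :: "('n::finite, 'd::finite) index"
  shows "index_dot (j + j') k mod (2 * int CARD('n))
       = (index_dot j k + index_dot j' k) mod (2 * int CARD('n))"
proof -
  have R: "Rep_bit0 (x + y) = (Rep_bit0 x + Rep_bit0 y) mod (2 * int CARD('n))" for x y :: "'n bit0"
    using bit0.Rep_Abs_mod[where 'a='n] by (simp add: bit0.definitions)
  have "index_dot (j + j') k mod (2 * int CARD('n)) = (\<Sum>i\<in>UNIV.
      ((Rep_bit0 (j $ i) + Rep_bit0 (j' $ i)) mod (2 * int CARD('n)) * Rep_bit0 (k $ i)) mod (2 * int CARD('n)))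
      mod (2 * int CARD('n))"
    unfolding index_dot_def by (simp add: R mod_sum_eq)
  also have "\<dots> = (\<Sum>i\<in>UNIV. (Rep_bit0 (j $ i) + Rep_bit0 (j' $ i)) * Rep_bit0 (k $ i)) mod (2 * int CARD('n))"
    by (simp add: mod_mult_left_eq mod_sum_eq)
  finally show ?thesis
    by (simp add: index_dot_def distrib_right sum.distrib)
qed

lemma dft_char_add: "dft_char (j + j') k = dft_char j k * dft_char j' k"
proof -
  have "dft_char (j + j') k =
      exp (2 * complex_of_real pi * \<i> * of_int (index_dot j k + index_dot j' k) / (2 * of_nat CARD('a)))"
    unfolding dft_char_def by (rule exp_cong_mod[OF index_dot_add_mod]) simp
  then show ?thesis
    by (simp add: dft_char_def exp_add [symmetric] add_divide_distrib algebra_simps)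
qed

lemma dft_char_0 [simp]: "dft_char 0 k = 1" "dft_char k 0 = 1"
proof -
  show "dft_char 0 k = 1" for k :: "('a, 'b) index"
    by (simp add: dft_char_def index_dot_def bit0.Rep_0)
  then show "dft_char k 0 = 1"
    by (simp add: dft_char_commute[of k])
qed

text \<open>Both sides are inverses of \<open>dft_char j k\<close>: the left because it has modulus
  1, the right by additivity.\<close>

lemma cnj_dft_char: "cnj (dft_char j k) = dft_char (- j) k"
proof -
  have "cmod (dft_char j k) = 1"
    by (simp add: dft_char_def norm_exp_eq_Re)
  then have "dft_char j k * cnj (dft_char j k) = 1"
    by (simp add: complex_norm_square [symmetric])
  moreover have "dft_char j k * dft_char (- j) k = 1"
    by (simp add: dft_char_add [symmetric])
  ultimately show ?thesis
    by (metis mult_cancel_left zero_neq_one mult_zero_left)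
qed

lemma dft_char_minus: "dft_char (- j) k = dft_char j (- k)"
  by (metis cnj_dft_char dft_char_commute)

lemma dft_char_diff: "dft_char (j - j') k = dft_char j k * cnj (dft_char j' k)"
  using dft_char_add[of j "- j'" k] by (simp add: cnj_dft_char)

lemma dft_char_diff_right: "dft_char j (k - k') = dft_char j k * cnj (dft_char j k')"
  by (metis dft_char_commute dft_char_diff)

section \<open>Orthogonality of characters and Fourier inversion\<close>

lemma dft_char_nontrivial:
  fixes k :: "('n::finite, 'd::finite) index"
  assumes "k \<noteq> 0"
  obtains j where "dft_char j k \<noteq> 1"
proof -
  from assms obtain i where i: "k $ i \<noteq> 0"
    by (auto simp: vec_eq_iff)
  define r where "r = Rep_bit0 (k $ i)"
  have "r \<noteq> 0"
    using i by (simp add: r_def bit0.Rep_inject_sym bit0.Rep_0)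
  have "0 \<le> r" "r < 2 * int CARD('n)"
    using Rep_bit0[of "k $ i"] by (auto simp: r_def)
  \<comment> \<open>The unit vector in a coordinate where \<open>k\<close> is nonzero picks out
    \<open>r\<close> with \<open>0 < r < 2N\<close>, and then \<open>r / 2N\<close> is not an
    integer.\<close>
  have "index_dot (axis i 1) k = (\<Sum>l\<in>UNIV. if l = i then r else 0)"
    unfolding index_dot_def by (intro sum.cong) (auto simp: axis_def r_def bit0.Rep_0 bit0.Rep_1)
  then have dot: "index_dot (axis i 1) k = r"
    by simp
  have "dft_char (axis i 1) k \<noteq> 1"
  proof
    assume "dft_char (axis i 1) k = 1"
    then obtain q :: int where
      "2 * complex_of_real pi * \<i> * of_int r / (2 * of_nat CARD('n)) = of_int (2 * q) * pi * \<i>"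
      unfolding dft_char_def dot exp_eq_1 by (auto simp: complex_eq_iff)
    then have "complex_of_int r = of_int (2 * int CARD('n) * q)"
      by (simp add: field_simps)
    then have "r = 2 * int CARD('n) * q"
      using of_int_eq_iff by blast
    then have "2 * int CARD('n) dvd r"
      by simp
    with \<open>r \<noteq> 0\<close> \<open>0 \<le> r\<close> \<open>r < 2 * int CARD('n)\<close> show False
      using zdvd_not_zless by fastforce
  qed
  then show ?thesis by (rule that)
qed

text \<open>Shifting the summation index by \<open>l\<close> multiplies the sum by
  \<open>dft_char l k\<close>, which can be chosen different from 1 unless
  \<open>k = 0\<close>.\<close>

lemma sum_dft_char:
  fixes k :: "('n::finite, 'd::finite) index"
  shows "(\<Sum>j\<in>UNIV. dft_char j k) = (if k = 0 then of_nat CARD(('n, 'd) index) else 0)"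
proof (cases "k = 0")
  case False
  then obtain l where l: "dft_char l k \<noteq> 1"
    by (rule dft_char_nontrivial)
  have "(\<Sum>j\<in>UNIV. dft_char j k) = (\<Sum>j\<in>UNIV. dft_char (l + j) k)"
    by (rule sum.reindex_bij_witness[of _ "\<lambda>j. l + j" "\<lambda>j. j - l"]) auto
  also have "\<dots> = dft_char l k * (\<Sum>j\<in>UNIV. dft_char j k)"
    by (simp add: dft_char_add sum_distrib_left)
  finally show ?thesis
    using l False by simp
qed simp

text \<open>Taking real parts makes this an image for every \<open>F\<close>; it inverts the transform on
  Hermitian-symmetric \<open>F\<close> only.\<close>

definition idft :: "(('n::finite, 'd::finite) index \<Rightarrow> complex) \<Rightarrow> ('n, 'd) image" where
  "idft F = (\<chi> j. (\<Sum>k\<in>UNIV. Re (F k * cnj (dft_char j k))) / of_nat CARD(('n, 'd) index))"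

lemma idft_dft [simp]: "idft (dft f) = f"
proof (rule vec_eq_iff[THEN iffD2], rule allI)
  fix j :: "('a, 'b) index"
  have "(\<Sum>k\<in>UNIV. dft f k * cnj (dft_char j k))
      = (\<Sum>k\<in>UNIV. \<Sum>i\<in>UNIV. complex_of_real (f $ i) * dft_char k (i - j))"
    by (simp add: dft_eq sum_distrib_right dft_char_diff_right
        dft_char_commute mult.assoc)
  also have "\<dots> = (\<Sum>i\<in>UNIV. complex_of_real (f $ i) * (\<Sum>k\<in>UNIV. dft_char k (i - j)))"
    by (subst sum.swap) (simp add: sum_distrib_left)
  also have "\<dots> = (\<Sum>i\<in>UNIV. if i = j then complex_of_real (f $ i) * of_nat CARD(('a, 'b) index) else 0)"
    by (intro sum.cong refl) (simp add: sum_dft_char del: card_bit0 CARD_vec)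
  also have "\<dots> = complex_of_real (f $ j * of_nat CARD(('a, 'b) index))"
    by (simp del: card_bit0 CARD_vec)
  finally have "(\<Sum>k\<in>UNIV. Re (dft f k * cnj (dft_char j k))) = f $ j * of_nat CARD(('a, 'b) index)"
    by (metis Re_complex_of_real Re_sum)
  then show "idft (dft f) $ j = f $ j"
    by (simp add: idft_def del: card_bit0 CARD_vec)
qed

lemma dft_inject: "(\<And>k. dft f k = dft g k) \<Longrightarrow> f = g"
  by (metis ext idft_dft)

lemma dft_minus_index: "dft f (- k) = cnj (dft f k)"
  by (simp add: dft_eq cnj_dft_char dft_char_minus)

text \<open>Hermitian symmetry makes the inversion sum equal to its own conjugate, so the real parts
  taken in \<open>idft\<close> lose nothing; orthogonality of characters does the rest.\<close>

lemma dft_idft: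
  fixes F :: "('n::finite, 'd::finite) index \<Rightarrow> complex"
  assumes herm: "\<And>k. F (- k) = cnj (F k)"
  shows "dft (idft F) k = F k"
proof -
  define n where "n = CARD(('n, 'd) index)"
  have "n \<noteq> 0" unfolding n_def by simp
  have real: "complex_of_real (\<Sum>l\<in>UNIV. Re (F l * cnj (dft_char j l)))
      = (\<Sum>l\<in>UNIV. F l * cnj (dft_char j l))" (is "_ = ?S") for j
  proof -
    have "cnj ?S = (\<Sum>l\<in>UNIV. F (- l) * cnj (dft_char j (- l)))"
      by (simp add: herm cnj_dft_char dft_char_minus)
    also have "\<dots> = ?S"
      by (rule sum.reindex_bij_witness[of _ uminus uminus]) auto
    finally have "?S \<in> \<real>"
      by (simp add: Reals_cnj_iff)
    then have "complex_of_real (Re ?S) = ?S"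
      by (rule of_real_Re)
    then show ?thesis
      by (simp only: Re_sum)
  qed
  have idft_F: "complex_of_real (idft F $ j) = (\<Sum>l\<in>UNIV. F l * cnj (dft_char j l)) / of_nat n" for j
    by (simp only: idft_def vec_lambda_beta of_real_divide real n_def of_real_of_nat_eq)
  have "dft (idft F) k = (\<Sum>j\<in>UNIV. (\<Sum>l\<in>UNIV. F l * dft_char j (k - l)) / of_nat n)"
    unfolding dft_eq
    by (intro sum.cong refl)
       (simp add: idft_F sum_distrib_left sum_distrib_right dft_char_diff_right mult_ac)
  also have "\<dots> = (\<Sum>l\<in>UNIV. F l * (\<Sum>j\<in>UNIV. dft_char j (k - l))) / of_nat n"
    by (simp add: sum_divide_distrib [symmetric] sum_distrib_left) (subst sum.swap, simp)
  also have "(\<Sum>l\<in>UNIV. F l * (\<Sum>j\<in>UNIV. dft_char j (k - l)))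
      = (\<Sum>l\<in>UNIV. if l = k then F l * of_nat n else 0)"
    unfolding n_def
    by (intro sum.cong refl) (simp add: sum_dft_char del: card_bit0 CARD_vec)
  finally show ?thesis
    using \<open>n \<noteq> 0\<close> by simp
qed

section \<open>Linearity and the transforms of translates\<close>

lemma bounded_linear_dft: "bounded_linear (\<lambda>f. dft f k)"
  by (intro linear_conv_bounded_linear[THEN iffD1] linearI)
     (simp_all add: dft_eq distrib_right sum.distrib sum_distrib_left mult.assoc scaleR_conv_of_real[where 'a = complex])

lemmas dft_0 = linear_0[OF bounded_linear.linear[OF bounded_linear_dft]]
lemmas dft_add = linear_add[OF bounded_linear.linear[OF bounded_linear_dft]]
lemmas dft_diff = linear_diff[OF bounded_linear.linear[OF bounded_linear_dft]]
lemmas dft_scaleR = linear_scale[OF bounded_linear.linear[OF bounded_linear_dft]]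
lemmas dft_sum = linear_sum[OF bounded_linear.linear[OF bounded_linear_dft]]

lemma dft_translate: "dft (translate v f) k = dft_char v k * dft f k"
proof -
  have "dft (translate v f) k = (\<Sum>j\<in>UNIV. complex_of_real (f $ j) * dft_char (j + v) k)"
    unfolding dft_eq translate_def
    by (rule sum.reindex_bij_witness[of _ "\<lambda>j. j + v" "\<lambda>j. j - v"]) auto
  then show ?thesis
    by (simp add: dft_eq dft_char_add sum_distrib_left mult_ac)
qed

text \<open>The combination is the convolution of \<open>f\<close> with \<open>g\<close> minus its
  reflection, and the transform turns convolution into a product.\<close>

lemma dft_sum_tau:
  "dft (\<Sum>v\<in>UNIV. g $ v *\<^sub>R tau f v) k = (dft g k - dft g (- k)) * dft f k"
  by (simp add: dft_sum dft_scaleR dft_diff tau_def dft_translate dft_char_minus dft_eq[of g]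
      scaleR_conv_of_real[where 'a = complex] algebra_simps sum_distrib_left sum_distrib_right sum_subtractf)

lemma dft_sum_nu:
  "dft (\<Sum>v\<in>UNIV. g $ v *\<^sub>R nu f v) k = (dft g k + dft g (- k)) * dft f k"
  by (simp add: dft_sum dft_scaleR dft_add nu_def dft_translate dft_char_minus dft_eq[of g]
      scaleR_conv_of_real[where 'a = complex] algebra_simps sum_distrib_left sum_distrib_right sum.distrib)

section \<open>The span of the \<open>tau\<close> vectors on the transform side\<close>

text \<open>Replaces an existential \<open>t\<close> by an explicit one, whose oddness in the
  frequency can then be read off from \<open>Im_divide_cnj\<close>. For \<open>w = 0\<close> both
  sides vanish.\<close>

lemma phase_Im_divide:
  assumes "z = \<i> * complex_of_real t * w"
  shows "z = \<i> * complex_of_real (Im (z / w)) * w"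
  using assms by (cases "w = 0") auto

lemma Im_divide_cnj: "Im (cnj z / cnj w) = - Im (z / w)"
  by (metis complex_cnj_divide cnj.simps(2))

lemma mem_span_tau_iff:
  "w \<in> span (range (tau f)) \<longleftrightarrow> (\<forall>k. \<exists>t. dft w k = \<i> * complex_of_real t * dft f k)"
proof
  assume "w \<in> span (range (tau f))"
  then show "\<forall>k. \<exists>t. dft w k = \<i> * complex_of_real t * dft f k"
  proof (induction rule: span_induct)
    case base
    show ?case
    proof (intro subspaceI CollectI allI)
      fix k show "\<exists>t. dft 0 k = \<i> * complex_of_real t * dft f k"
        by (intro exI[of _ 0]) (simp add: dft_0)
    next
      fix x y k
      assume "x \<in> {w. \<forall>k. \<exists>t. dft w k = \<i> * complex_of_real t * dft f k}"
        and "y \<in> {w. \<forall>k. \<exists>t. dft w k = \<i> * complex_of_real t * dft f k}"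
      then obtain s t where "dft x k = \<i> * complex_of_real s * dft f k"
        "dft y k = \<i> * complex_of_real t * dft f k" by blast
      then show "\<exists>t. dft (x + y) k = \<i> * complex_of_real t * dft f k"
        by (intro exI[of _ "s + t"]) (simp add: dft_add algebra_simps)
    next
      fix c x k
      assume "x \<in> {w. \<forall>k. \<exists>t. dft w k = \<i> * complex_of_real t * dft f k}"
      then obtain s where "dft x k = \<i> * complex_of_real s * dft f k" by blast
      then show "\<exists>t. dft (c *\<^sub>R x) k = \<i> * complex_of_real t * dft f k"
        by (intro exI[of _ "c * s"]) (simp add: dft_scaleR scaleR_conv_of_real[where 'a = complex])
    qed
  next
    case (step x)
    then obtain v where x: "x = tau f v" by blast
    have "dft x k = \<i> * complex_of_real (2 * Im (dft_char v k)) * dft f k" for k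
      unfolding x tau_def dft_diff dft_translate cnj_dft_char [symmetric] left_diff_distrib [symmetric]
        complex_diff_cnj by (simp add: mult_ac)
    then show ?case by blast
  qed
next
  assume "\<forall>k. \<exists>t. dft w k = \<i> * complex_of_real t * dft f k"
  then have w: "dft w k = \<i> * complex_of_real (Im (dft w k / dft f k)) * dft f k" for k
    using phase_Im_divide by blast
  \<comment> \<open>The multiplier is \<open>\<i>\<close> times an odd real function, hence
    Hermitian, so it is the transform of a real image. Being purely imaginary, it is doubled by
    \<open>dft g k - dft g (- k)\<close>; this explains the factor 1/2 below.\<close>
  define g where "g = idft (\<lambda>k. \<i> * complex_of_real (Im (dft w k / dft f k)))"
  have g: "dft g k = \<i> * complex_of_real (Im (dft w k / dft f k))" for k
    unfolding g_def by (rule dft_idft) (simp add: dft_minus_index Im_divide_cnj del: complex_cnj_divide)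
  have "w = (1/2) *\<^sub>R (\<Sum>v\<in>UNIV. g $ v *\<^sub>R tau f v)"
  proof (rule dft_inject)
    fix k
    have "dft ((1/2) *\<^sub>R (\<Sum>v\<in>UNIV. g $ v *\<^sub>R tau f v)) k = dft g k * dft f k"
      unfolding dft_scaleR dft_sum_tau dft_minus_index by (simp add: g scaleR_conv_of_real[where 'a = complex])
    then show "dft w k = dft ((1/2) *\<^sub>R (\<Sum>v\<in>UNIV. g $ v *\<^sub>R tau f v)) k"
      using w[of k] g[of k] by simp
  qed
  then show "w \<in> span (range (tau f))"
    by (simp add: span_scale span_sum span_base)
qed

section \<open>The tangent space\<close>

lemma has_vector_derivative_constant_norm:
  fixes h :: "real \<Rightarrow> 'a::real_inner"
  assumes "(h has_vector_derivative h') (at x)" "open S" "x \<in> S" "\<And>t. t \<in> S \<Longrightarrow> norm (h t) = c"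
  shows "inner (h x) h' = 0"
proof -
  have "((\<lambda>t. inner (h t) (h t)) has_vector_derivative inner (h x) h' + inner h' (h x)) (at x)"
    by (rule bounded_bilinear.has_vector_derivative[OF bounded_bilinear_inner assms(1) assms(1)])
  moreover have "((\<lambda>t. inner (h t) (h t)) has_vector_derivative 0) (at x)"
  proof (rule has_vector_derivative_transform_within_open[OF _ assms(2,3)])
    show "((\<lambda>t. c\<^sup>2) has_vector_derivative 0) (at x)" by simp
    show "c\<^sup>2 = inner (h t) (h t)" if "t \<in> S" for t
      using assms(4)[OF that] by (simp add: power2_norm_eq_inner [symmetric])
  qed
  ultimately have "inner (h x) h' + inner h' (h x) = 0"
    by (rule vector_derivative_unique_at)
  then show ?thesis
    by (simp add: inner_commute)
qed

lemma has_vector_derivative_idft: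
  assumes "\<And>k. ((\<lambda>t. F t k) has_vector_derivative F' k) (at x)"
  shows "((\<lambda>t. idft (F t)) has_vector_derivative idft F') (at x)"
proof -
  \<comment> \<open>\<open>L k z\<close> is the contribution of frequency \<open>k\<close> to
    \<open>idft\<close>. It is linear over the reals, so \<open>idft\<close> can be differentiated
    term by term.\<close>
  define L where "L k z = ((\<chi> j. Re (z * cnj (dft_char j k)) / of_nat CARD(('a, 'b) index)) :: ('a, 'b) image)"
    for k z
  have idft_sum: "idft G = (\<Sum>k\<in>UNIV. L k (G k))" for G
    by (intro vec_eq_iff[THEN iffD2] allI) (simp only: idft_def L_def vec_lambda_beta sum_component sum_divide_distrib)
  have "bounded_linear (L k)" for k
    by (intro linear_conv_bounded_linear[THEN iffD1] linearI)
       (simp_all add: L_def vec_eq_iff algebra_simps add_divide_distrib diff_divide_distrib)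
  then have "((\<lambda>t. L k (F t k)) has_vector_derivative L k (F' k)) (at x)" for k
    by (rule bounded_linear.has_vector_derivative[OF _ assms])
  then show ?thesis
    unfolding idft_sum by (rule has_vector_derivative_sum)
qed

lemma continuous_on_idft:
  assumes "\<And>k. continuous_on S (\<lambda>t. F t k)"
  shows "continuous_on S (\<lambda>t. idft (F t))"
  unfolding idft_def
  by (intro continuous_on_vec_lambda continuous_intros assms) auto

lemma tangent_space_magnitude_torus:
  assumes "f \<in> magnitude_torus a"
  shows "tangent_space_at (magnitude_torus a) f = span (range (tau f))"
proof (intro equalityI subsetI)
  fix w assume "w \<in> tangent_space_at (magnitude_torus a) f"
  then obtain \<gamma> e where e: "0 < e" and sub: "\<gamma> ` {-e<..<e} \<subseteq> magnitude_torus a"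
    and \<gamma>0: "\<gamma> 0 = f" and d: "(\<gamma> has_vector_derivative w) (at 0)"
    unfolding tangent_space_at_def by blast
  have "\<exists>t. dft w k = \<i> * complex_of_real t * dft f k" for k
  proof -
    have d': "((\<lambda>t. dft (\<gamma> t) k) has_vector_derivative dft w k) (at 0)"
      by (rule bounded_linear.has_vector_derivative[OF bounded_linear_dft d])
    have n: "cmod (dft (\<gamma> t) k) = a $ k" if "t \<in> {-e<..<e}" for t
      using subsetD[OF sub imageI[OF that]] by (simp add: magnitude_torus_def)
    have 0: "(0::real) \<in> {-e<..<e}" using e by simp
    show ?thesis
    proof (cases "dft f k = 0")
      \<comment> \<open>The circle at this frequency degenerates to a point: the curve has transform
        0 at \<open>k\<close> throughout the interval.\<close>
      case True
      have "((\<lambda>t. 0) has_vector_derivative dft w k) (at 0)"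
        by (rule has_vector_derivative_transform_within_open[OF d' _ 0])
           (use n True n[OF 0] \<gamma>0 in auto)
      then have "dft w k = 0"
        by (metis vector_derivative_unique_at has_vector_derivative_const)
      then show ?thesis by (simp add: True)
    next
      case False
      \<comment> \<open>Velocity on a circle is perpendicular to the radius, so the quotient of the
        two complex numbers is purely imaginary.\<close>
      have "inner (dft f k) (dft w k) = 0"
        using has_vector_derivative_constant_norm[OF d' _ 0 n] \<gamma>0 by simp
      then have "Re (dft w k / dft f k) = 0"
        by (simp add: inner_complex_def Re_divide mult_ac)
      then have "dft w k / dft f k = \<i> * complex_of_real (Im (dft w k / dft f k))"
        by (simp add: complex_eq_iff)
      then show ?thesis using False by (metis nonzero_divide_eq_eq)
    qed
  qed
  then show "w \<in> span (range (tau f))"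
    by (simp add: mem_span_tau_iff)
next
  fix w assume "w \<in> span (range (tau f))"
  \<comment> \<open>Angular speeds of the curve constructed next; where \<open>dft f k = 0\<close>,
    division by zero gives speed 0.\<close>
  define \<theta> where "\<theta> k = Im (dft w k / dft f k)" for k
  have w: "dft w k = \<i> * complex_of_real (\<theta> k) * dft f k" for k
    using \<open>w \<in> _\<close> phase_Im_divide unfolding mem_span_tau_iff \<theta>_def by blast
  have odd: "\<theta> (- k) = - \<theta> k" for k
    unfolding \<theta>_def dft_minus_index by (rule Im_divide_cnj)
  define \<gamma> where "\<gamma> t = idft (\<lambda>k. exp (complex_of_real t * (\<i> * \<theta> k)) * dft f k)" for t
  \<comment> \<open>The termwise derivative of \<open>\<gamma>\<close>, given for all
    \<open>t\<close> because a C1 curve needs a continuous derivative.\<close>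
  define D where "D t = idft (\<lambda>k. exp (complex_of_real t * (\<i> * \<theta> k)) * (\<i> * \<theta> k * dft f k))" for t
  have "dft (\<gamma> t) k = exp (complex_of_real t * (\<i> * \<theta> k)) * dft f k" for t k
    \<comment> \<open>Oddness of \<open>\<theta>\<close> keeps the rotated transform
      Hermitian.\<close>
    unfolding \<gamma>_def by (rule dft_idft) (simp add: odd dft_minus_index exp_cnj)
  then have "\<gamma> t \<in> magnitude_torus a" for t
    using assms by (simp add: magnitude_torus_def norm_mult norm_exp_eq_Re)
  moreover have D: "(\<gamma> has_vector_derivative D t) (at t)" for t
    unfolding \<gamma>_def D_def
    by (intro has_vector_derivative_idft)
       (auto intro!: derivative_eq_intros has_vector_derivative_real_field simp: mult_ac)
  moreover have "continuous_on S D" for S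
    unfolding D_def by (intro continuous_on_idft continuous_intros)
  moreover have "\<gamma> 0 = f"
    by (simp add: \<gamma>_def eta_contract_eq)
  moreover have "D 0 = w"
    by (simp add: D_def w [symmetric])
  then have "(\<gamma> has_vector_derivative w) (at 0)"
    using D by metis
  ultimately show "w \<in> tangent_space_at (magnitude_torus a) f"
    unfolding tangent_space_at_def C1_differentiable_on_def
    by (intro CollectI exI[of _ \<gamma>] exI[of _ 1] conjI exI[of _ D]) auto
qed

section \<open>The normal space\<close>

lemma inner_translate: "inner (translate u f) (translate v f) = inner f (translate (v - u) f)"
  unfolding inner_vec_def translate_def
  by (rule sum.reindex_bij_witness[of _ "\<lambda>j. j + u" "\<lambda>j. j - u"]) (auto simp: algebra_simps)

text \<open>Expanding gives four autocorrelation values of \<open>f\<close>, at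
  \<open>v - u\<close>, \<open>- v - u\<close>, \<open>v + u\<close> and \<open>u - v\<close>, the
  last two with negative sign; evenness cancels them in pairs.\<close>

lemma inner_tau_nu: "inner (tau f u) (nu f v) = 0"
proof -
  have even: "inner f (translate (- x) f) = inner f (translate x f)" for x
    using inner_translate[of x f 0] inner_translate[of 0 f x] by (simp add: inner_commute)
  have "inner f (translate (u - v) f) = inner f (translate (v - u) f)"
    "inner f (translate (- v - u) f) = inner f (translate (v + u) f)"
    using even[of "v - u"] even[of "v + u"] by simp_all
  then show ?thesis
    by (simp add: tau_def nu_def inner_diff_left inner_add_right inner_translate)
qed

lemma span_tau_plus_span_nu:
  assumes "\<And>k. dft f k \<noteq> 0"
  obtains y z where "x = y + z" "y \<in> span (range (tau f))" "z \<in> span (range (nu f))"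
proof -
  \<comment> \<open>Deconvolution: \<open>g\<close> convolved with \<open>f\<close> is
    \<open>x\<close>. The quotient is Hermitian since \<open>x\<close> and \<open>f\<close> are
    real. Splitting \<open>g\<close> into odd and even parts yields the \<open>tau\<close> and
    \<open>nu\<close> summands.\<close>
  define g where "g = idft (\<lambda>k. dft x k / dft f k)"
  have g: "dft g k = dft x k / dft f k" for k
    unfolding g_def by (rule dft_idft) (simp add: dft_minus_index)
  let ?y = "\<Sum>v\<in>UNIV. (g $ v) *\<^sub>R tau f v" and ?z = "\<Sum>v\<in>UNIV. (g $ v) *\<^sub>R nu f v"
  have "x = (1/2) *\<^sub>R ?y + (1/2) *\<^sub>R ?z"
  proof (rule dft_inject)
    fix k
    have "dft ((1/2) *\<^sub>R ?y + (1/2) *\<^sub>R ?z) k = dft g k * dft f k"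
      unfolding dft_add dft_scaleR dft_sum_tau dft_sum_nu
      by (simp add: scaleR_conv_of_real[where 'a = complex] algebra_simps)
    then show "dft x k = dft ((1/2) *\<^sub>R ?y + (1/2) *\<^sub>R ?z) k"
      using assms by (simp add: g)
  qed
  then show ?thesis
    by (rule that) (simp_all add: span_scale span_sum span_base)
qed

lemma orthogonal_comp_span_tau:
  assumes "\<And>k. dft f k \<noteq> 0"
  shows "orthogonal_comp (span (range (tau f))) = span (range (nu f))"
proof -
  have orth: "orthogonal y z" if "y \<in> span (range (tau f))" "z \<in> span (range (nu f))" for y z
  proof -
    have "orthogonal (tau f u) z" for u
      by (rule orthogonal_to_span[OF that(2)]) (auto simp: orthogonal_def inner_tau_nu)
    then have "orthogonal z y"
      by (intro orthogonal_to_span[OF that(1)]) (auto simp: orthogonal_commute)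
    then show ?thesis
      by (simp add: orthogonal_commute)
  qed
  show ?thesis
  proof (intro equalityI subsetI)
    fix x assume x: "x \<in> orthogonal_comp (span (range (tau f)))"
    obtain y z where yz: "x = y + z" "y \<in> span (range (tau f))" "z \<in> span (range (nu f))"
      by (rule span_tau_plus_span_nu[OF assms])
    \<comment> \<open>The component \<open>y\<close> is orthogonal to both \<open>x\<close> and
      \<open>z\<close>, hence to \<open>x - z\<close>, which is \<open>y\<close> itself.\<close>
    have "orthogonal y x" "orthogonal y z"
      using x orth yz by (auto simp: orthogonal_comp_def)
    then have "y = 0"
      by (simp add: orthogonal_def yz(1) inner_add_right)
    then show "x \<in> span (range (nu f))"
      using yz by simp
  qed (use orth in \<open>auto simp: orthogonal_comp_def\<close>)
qed

text \<open>The second equality is conditional because at a frequency with \<open>a $ k = 0\<close>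
  the transforms of all \<open>tau f v\<close> and \<open>nu f v\<close> vanish, and together they
  cannot fill the space.\<close>

theorem theorem2p1:
  fixes a f :: "('n::finite, 'd::finite) image"
  assumes "\<exists>g :: ('n, 'd) image. a = magnitude_data g"
    and "f \<in> magnitude_torus a"
  shows "tangent_space_at (magnitude_torus a) f = span (range (tau f)) \<and>
    ((\<forall>k. a $ k \<noteq> 0) \<longrightarrow>
      normal_space_at (magnitude_torus a) f = span (range (nu f)))"
proof (intro conjI impI)
  show tangent: "tangent_space_at (magnitude_torus a) f = span (range (tau f))"
    by (rule tangent_space_magnitude_torus[OF assms(2)])
  assume "\<forall>k. a $ k \<noteq> 0"
  then have "dft f k \<noteq> 0" for k
    using assms(2) by (auto simp: magnitude_torus_def) (metis norm_zero)
  then show "normal_space_at (magnitude_torus a) f = span (range (nu f))"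
    unfolding normal_space_at_def tangent by (rule orthogonal_comp_span_tau)
qed

end
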